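(* There is an algorithm that, given a context-free grammar $G$, decides whether $L(G)$ is subword-free.
   Context: A word $u$ is a subword of $w$ if $u$ can be obtained from $w$ by deleting some (not necessarily contiguous) letters. A language $L$ is subword-free if no word of $L$ has a subword different from itself that also lies in $L$. *)

theory Defs
  imports Main "HOL-Library.Sublist" "HOL-Library.Nat_Bijection"
begin

section \<open>Context-free grammars\<close>

datatype ('n, 't) sym = Nt 'n | Tm 't

text \<open>The finite components of a grammar \<open>(V, \<Sigma>, P, S)\<close> are given as lists, since a grammar is
  an input to an algorithm; order and repetitions are irrelevant for the generated language.\<close>

datatype ('n, 't) cfg =
  Cfg (nonterms: "'n list") (terms: "'t list") (prods: "('n \<times> ('n, 't) sym list) list") (start: 'n)

definition symbols :: "('n, 't) cfg \<Rightarrow> ('n, 't) sym set" where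
  "symbols G = Nt ` set (nonterms G) \<union> Tm ` set (terms G)"

definition wf_cfg :: "('n, 't) cfg \<Rightarrow> bool" where
  "wf_cfg G \<longleftrightarrow> start G \<in> set (nonterms G) \<and>
     (\<forall>(A, \<alpha>) \<in> set (prods G). A \<in> set (nonterms G) \<and> set \<alpha> \<subseteq> symbols G)"

inductive derives1 :: "('n, 't) cfg \<Rightarrow> ('n, 't) sym list \<Rightarrow> ('n, 't) sym list \<Rightarrow> bool"
  for G where
  "(A, \<alpha>) \<in> set (prods G) \<Longrightarrow> derives1 G (u @ [Nt A] @ v) (u @ \<alpha> @ v)"

definition lang :: "('n, 't) cfg \<Rightarrow> 't list set" where
  "lang G = {w. (derives1 G)\<^sup>*\<^sup>* [Nt (start G)] (map Tm w)}"

definition subword_free :: "'t list set \<Rightarrow> bool" where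
  "subword_free L \<longleftrightarrow> \<not> (\<exists>w \<in> L. \<exists>u \<in> L. subseq u w \<and> u \<noteq> w)"


section \<open>Algorithms: partial recursive functions\<close>

datatype recf =
    Zero
  | Succ
  | Proj nat
  | Comp recf "recf list"
  | PrimRec recf recf
  | Mu recf

text \<open>\<open>computes f xs y\<close>: the program \<open>f\<close> halts on the argument tuple \<open>xs\<close> with output \<open>y\<close>.
  Recursion and minimization act on the first argument; in \<open>PrimRec\<close> the step function
  receives the counter, the previous value and the parameters, in this order.\<close>

inductive computes :: "recf \<Rightarrow> nat list \<Rightarrow> nat \<Rightarrow> bool" where
  Zero: "computes Zero xs 0"
| Succ: "computes Succ [x] (Suc x)"
| Proj: "i < length xs \<Longrightarrow> computes (Proj i) xs (xs ! i)"
| Comp: "list_all2 (\<lambda>g y. computes g xs y) gs ys \<Longrightarrow> computes f ys z \<Longrightarrow>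
    computes (Comp f gs) xs z"
| PrimRec_0: "computes f xs y \<Longrightarrow> computes (PrimRec f g) (0 # xs) y"
| PrimRec_Suc: "computes (PrimRec f g) (n # xs) y \<Longrightarrow> computes g (n # y # xs) z \<Longrightarrow>
    computes (PrimRec f g) (Suc n # xs) z"
| Mu: "computes f (n # xs) 0 \<Longrightarrow> (\<And>m. m < n \<Longrightarrow> \<exists>y. computes f (m # xs) (Suc y)) \<Longrightarrow>
    computes (Mu f) xs n"

inductive_cases computes_elims:
  "computes Zero xs y" "computes Succ xs y" "computes (Proj i) xs y" "computes (Comp f gs) xs y"
  "computes (PrimRec f g) (0 # xs) y" "computes (PrimRec f g) (Suc n # xs) y"
  "computes (Mu f) xs y"

lemma computes_deterministic:
  assumes "computes f xs y" "computes f xs z"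
  shows "y = z"
  using assms
proof (induction arbitrary: z rule: computes.induct)
  case (Comp xs gs ys f y)
  obtain ys' where
    ys': "list_all2 (\<lambda>g y. computes g xs y) gs ys'" "computes f ys' z"
    using computes_elims(4)[OF Comp.prems] by metis
  have "ys = ys'"
  proof (rule nth_equalityI)
    show "length ys = length ys'"
      using list_all2_lengthD[OF Comp.IH(1)] list_all2_lengthD[OF ys'(1)] by simp
    fix i assume "i < length ys"
    then have i: "i < length gs" using list_all2_lengthD[OF Comp.IH(1)] by simp
    from list_all2_nthD[OF Comp.IH(1) i] list_all2_nthD[OF ys'(1) i] show "ys ! i = ys' ! i"
      by blast
  qed
  with ys'(2) Comp.IH(2) show ?case by blast
next
  case (Mu f n xs)
  from Mu.prems have z: "computes f (z # xs) 0"
    by (cases rule: computes.cases) simp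
  have less_z: "\<exists>y. computes f (m # xs) (Suc y)" if "m < z" for m
    using Mu.prems by (cases rule: computes.cases) (simp add: that)
  show ?case
  proof (cases n z rule: linorder_cases)
    case less
    from less_z[OF less] obtain y where "computes f (n # xs) (Suc y)" ..
    from Mu.IH(1)[OF this] show ?thesis by simp
  next
    case greater
    from Mu.IH(2)[OF greater] obtain y where "\<forall>v. computes f (z # xs) v \<longrightarrow> Suc y = v" by auto
    with z show ?thesis by auto
  qed
next
  case (PrimRec_0 f xs y g)
  from PrimRec_0.prems have "computes f xs z" by (rule computes_elims(5))
  then show ?case by (rule PrimRec_0.IH)
next
  case (PrimRec_Suc f g n xs y v)
  from PrimRec_Suc.prems obtain y' where y': "computes (PrimRec f g) (n # xs) y'"
    "computes g (n # y' # xs) z" by (rule computes_elims(6))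
  from PrimRec_Suc.IH(1)[OF y'(1)] y'(2) have "computes g (n # y # xs) z" by simp
  then show ?case by (rule PrimRec_Suc.IH(2))
qed (auto elim: computes_elims(1-3))


section \<open>Grammars as inputs\<close>

fun sym_encode :: "(nat, nat) sym \<Rightarrow> nat" where
  "sym_encode (Nt A) = sum_encode (Inl A)"
| "sym_encode (Tm a) = sum_encode (Inr a)"

definition prod_rule_encode :: "nat \<times> (nat, nat) sym list \<Rightarrow> nat" where
  "prod_rule_encode r = prod_encode (fst r, list_encode (map sym_encode (snd r)))"

definition cfg_encode :: "(nat, nat) cfg \<Rightarrow> nat" where
  "cfg_encode G = list_encode
     [list_encode (nonterms G), list_encode (terms G),
      list_encode (map prod_rule_encode (prods G)), start G]"

lemma inj_cfg_encode: "inj cfg_encode"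
proof -
  have s: "inj sym_encode"
  proof (rule injI)
    fix x y assume "sym_encode x = sym_encode y"
    then show "x = y"
      by (cases x; cases y)
        (simp_all only: sym_encode.simps sum_encode_eq sum.inject sum.distinct)
  qed
  have r: "inj prod_rule_encode"
  proof (rule injI)
    fix x y assume "prod_rule_encode x = prod_rule_encode y"
    then have "fst x = fst y" "map sym_encode (snd x) = map sym_encode (snd y)"
      by (simp_all add: prod_rule_encode_def list_encode_eq)
    with s show "x = y" by (simp add: prod_eq_iff)
  qed
  show ?thesis
  proof (rule injI)
    fix x y assume "cfg_encode x = cfg_encode y"
    then have "[list_encode (nonterms x), list_encode (terms x),
        list_encode (map prod_rule_encode (prods x)), start x] =
      [list_encode (nonterms y), list_encode (terms y),
        list_encode (map prod_rule_encode (prods y)), start y]"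
      unfolding cfg_encode_def list_encode_eq .
    then show "x = y" using r by (intro cfg.expand) (simp add: list_encode_eq)
  qed
qed

end

theory Submission
  imports Defs
begin

text \<open>Let \<open>n\<close> be the number of productions. If a word \<open>w\<close> first appears among the words with derivation
  trees of height at most \<open>h\<close>, then a longest path in such a tree consists of nonterminals and
  factors of \<open>w\<close> that first appear at heights \<open>h, h - 1, \<dots>, 1\<close>. Two nodes on it with the same nonterminal
  therefore yield different words, which gives two facts. Pigeonhole on pairs of nonterminal and
  length shows \<open>h \<le> n (|w| + 1)\<close>. If \<open>h > n\<close>, a repetition among the \<open>n + 1\<close> lowest nodes can be
  cut out, which leaves a proper subword of \<open>w\<close> in the language. Applied to a shortest word without a
  tree of height at most \<open>n\<close>, the second fact yields a violation of subword-freeness of bounded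
  length, and by the first one the heights of its derivation trees are bounded too.

  So it suffices to search for two comparable words among finitely many derivations, and the
  code of the grammar bounds all quantities involved.\<close>

section \<open>Heights of derivation trees\<close>

text \<open>\<open>gen G h \<alpha> w\<close>: there is a derivation forest of height at most \<open>h\<close> from \<open>\<alpha>\<close> to the terminal
  word \<open>w\<close>.\<close>

inductive gen :: "('n, 't) cfg \<Rightarrow> nat \<Rightarrow> ('n, 't) sym list \<Rightarrow> 't list \<Rightarrow> bool" for G where
  gen_Nil: "gen G h [] []"
| gen_Tm: "gen G h \<alpha> w \<Longrightarrow> gen G h (Tm a # \<alpha>) (a # w)"
| gen_Nt: "(A, \<beta>) \<in> set (prods G) \<Longrightarrow> gen G h \<beta> u \<Longrightarrow> gen G (Suc h) \<alpha> w \<Longrightarrow>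
    gen G (Suc h) (Nt A # \<alpha>) (u @ w)"

inductive_cases gen_NilE: "gen G h [] w"
inductive_cases gen_TmE: "gen G h (Tm a # \<alpha>) w"
inductive_cases gen_NtE: "gen G h (Nt A # \<alpha>) w"

section \<open>Derivation forests and rewriting steps\<close>

lemma gen_mono: "gen G h \<alpha> w \<Longrightarrow> h \<le> h' \<Longrightarrow> gen G h' \<alpha> w"
proof (induction arbitrary: h' rule: gen.induct)
  case (gen_Nt A \<beta> h u \<alpha> w)
  then obtain k where k: "h' = Suc k" "h \<le> k" by (cases h') auto
  with gen_Nt show ?case by (auto intro!: gen.gen_Nt)
qed (auto intro: gen.intros)

lemma gen_append: "gen G h \<alpha> u \<Longrightarrow> gen G h \<beta> v \<Longrightarrow> gen G h (\<alpha> @ \<beta>) (u @ v)"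
  by (induction rule: gen.induct) (auto intro: gen.intros)

lemma gen_append_split:
  "gen G h (\<alpha> @ \<beta>) w \<Longrightarrow> \<exists>u v. w = u @ v \<and> gen G h \<alpha> u \<and> gen G h \<beta> v"
proof (induction \<alpha> arbitrary: w)
  case Nil
  then show ?case by (auto intro: gen_Nil)
next
  case (Cons X \<alpha>)
  show ?case
  proof (cases X)
    case (Nt A)
    with Cons.prems obtain \<gamma> k u v where h: "h = Suc k" "w = u @ v" "(A, \<gamma>) \<in> set (prods G)"
      "gen G k \<gamma> u" "gen G (Suc k) (\<alpha> @ \<beta>) v" by (auto elim: gen_NtE)
    with Cons.IH obtain v1 v2 where "v = v1 @ v2" "gen G h \<alpha> v1" "gen G h \<beta> v2" by blast
    with h Nt have "w = (u @ v1) @ v2 \<and> gen G h (X # \<alpha>) (u @ v1) \<and> gen G h \<beta> v2"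
      by (auto intro: gen_Nt)
    then show ?thesis by blast
  next
    case (Tm a)
    with Cons.prems obtain v where "w = a # v" "gen G h (\<alpha> @ \<beta>) v" by (auto elim: gen_TmE)
    with Cons.IH obtain v1 v2 where "w = a # v1 @ v2" "gen G h \<alpha> v1" "gen G h \<beta> v2" by blast
    with Tm have "w = (a # v1) @ v2 \<and> gen G h (X # \<alpha>) (a # v1) \<and> gen G h \<beta> v2"
      by (auto intro: gen_Tm)
    then show ?thesis by blast
  qed
qed

lemma gen_single_Nt_iff:
  "gen G h [Nt A] w \<longleftrightarrow> (\<exists>k \<beta>. h = Suc k \<and> (A, \<beta>) \<in> set (prods G) \<and> gen G k \<beta> w)"
proof
  assume "gen G h [Nt A] w"
  then show "\<exists>k \<beta>. h = Suc k \<and> (A, \<beta>) \<in> set (prods G) \<and> gen G k \<beta> w"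
    by (auto elim!: gen_NtE gen_NilE)
next
  assume "\<exists>k \<beta>. h = Suc k \<and> (A, \<beta>) \<in> set (prods G) \<and> gen G k \<beta> w"
  then show "gen G h [Nt A] w" using gen_Nt[OF _ _ gen_Nil] by fastforce
qed

lemma gen_terminals: "gen G h (map Tm w) w"
  by (induction w) (auto intro: gen.intros)

text \<open>Induction from the front of the derivation: undoing its first step hangs the trees of
  \<beta> below a new node \<open>A\<close>, which costs at most one level.\<close>

lemma derives_imp_gen:
  "(derives1 G)\<^sup>*\<^sup>* \<alpha> (map Tm w) \<Longrightarrow> \<exists>h. gen G h \<alpha> w"
proof (induction rule: converse_rtranclp_induct)
  case base
  show ?case using gen_terminals by blast
next
  case (step \<alpha> \<alpha>')
  from step.hyps(1) obtain A \<beta> u v where A: "\<alpha> = u @ [Nt A] @ v" "\<alpha>' = u @ \<beta> @ v"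
    "(A, \<beta>) \<in> set (prods G)" by (auto elim: derives1.cases)
  with step.IH obtain h x y z where "w = x @ y @ z" "gen G h u x" "gen G h \<beta> y" "gen G h v z"
    by (metis gen_append_split)
  with A have "gen G (Suc h) \<alpha> w"
    by (auto intro!: gen_append gen_Nt elim: gen_mono)
  then show ?case ..
qed

lemma derives1_context:
  "derives1 G \<alpha> \<beta> \<Longrightarrow> derives1 G (u @ \<alpha> @ v) (u @ \<beta> @ v)"
proof (induction rule: derives1.induct)
  case (1 A \<alpha> x y)
  from derives1.intros[OF this, of "u @ x" "y @ v"] show ?case by simp
qed

lemma relpowp_derives1_context:
  "(derives1 G ^^ k) \<alpha> \<beta> \<Longrightarrow> (derives1 G ^^ k) (u @ \<alpha> @ v) (u @ \<beta> @ v)"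
proof (induction k arbitrary: \<beta>)
  case (Suc k)
  then show ?case by (auto intro: derives1_context)
qed simp

text \<open>Each root of the forest accounts for at most \<open>(c + 2) ^ h\<close> steps of a
  leftmost derivation. A tree of height \<open>Suc h\<close> takes one step at its root and then
  those of at most \<open>c\<close> subtrees; the base exceeds \<open>c\<close>, which absorbs the
  root step.\<close>

lemma gen_imp_derives:
  assumes "\<And>A \<beta>. (A, \<beta>) \<in> set (prods G) \<Longrightarrow> length \<beta> \<le> c"
  shows "gen G h \<alpha> w \<Longrightarrow> \<exists>k \<le> length \<alpha> * (c + 2) ^ h. (derives1 G ^^ k) \<alpha> (map Tm w)"
proof (induction rule: gen.induct)
  case (gen_Tm h \<alpha> w a)
  then obtain k where k: "k \<le> length \<alpha> * (c + 2) ^ h" "(derives1 G ^^ k) \<alpha> (map Tm w)" by blast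
  from relpowp_derives1_context[OF k(2), of "[Tm a]" "[]"]
  have "(derives1 G ^^ k) (Tm a # \<alpha>) (map Tm (a # w))" by simp
  moreover have "k \<le> length (Tm a # \<alpha>) * (c + 2) ^ h" using k(1) by simp
  ultimately show ?case by blast
next
  case (gen_Nt A \<beta> h u \<alpha> w)
  then obtain k l where k: "k \<le> length \<beta> * (c + 2) ^ h" "(derives1 G ^^ k) \<beta> (map Tm u)"
    and l: "l \<le> length \<alpha> * (c + 2) ^ Suc h" "(derives1 G ^^ l) \<alpha> (map Tm w)" by blast
  have "derives1 G (Nt A # \<alpha>) (\<beta> @ \<alpha>)"
    using derives1.intros[OF gen_Nt.hyps(1), of "[]" \<alpha>] by simp
  moreover have "(derives1 G ^^ k) (\<beta> @ \<alpha>) (map Tm u @ \<alpha>)"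
    using relpowp_derives1_context[OF k(2), of "[]" \<alpha>] by simp
  moreover have "(derives1 G ^^ l) (map Tm u @ \<alpha>) (map Tm (u @ w))"
    using relpowp_derives1_context[OF l(2), of "map Tm u" "[]"] by simp
  ultimately have "(derives1 G ^^ (Suc (k + l))) (Nt A # \<alpha>) (map Tm (u @ w))"
    by (meson relpowp_Suc_I2 relpowp_trans)
  moreover have "Suc (k + l) \<le> length (Nt A # \<alpha>) * (c + 2) ^ Suc h"
  proof -
    define M where "M = (c + 2) ^ h"
    have "k \<le> c * M"
      using k(1) mult_le_mono1[OF assms[OF gen_Nt.hyps(1)]] le_trans unfolding M_def by blast
    moreover have "1 \<le> M" unfolding M_def by simp
    ultimately show ?thesis using l(1) unfolding power_Suc M_def[symmetric]
      by (simp add: algebra_simps)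
  qed
  ultimately show ?case by blast
qed auto

lemma gen_length:
  assumes "\<And>A \<beta>. (A, \<beta>) \<in> set (prods G) \<Longrightarrow> length \<beta> \<le> c"
  shows "gen G h \<alpha> w \<Longrightarrow> length w \<le> length \<alpha> * (c + 2) ^ h"
proof (induction rule: gen.induct)
  case (gen_Tm h \<alpha> w a)
  define M where "M = (c + 2) ^ h"
  have "1 \<le> M" unfolding M_def by simp
  with gen_Tm.IH show ?case unfolding M_def[symmetric] by simp
next
  case (gen_Nt A \<beta> h u \<alpha> w)
  have "length u \<le> c * (c + 2) ^ h"
    using gen_Nt.IH(1) mult_le_mono1[OF assms[OF gen_Nt.hyps(1)]] le_trans by blast
  with gen_Nt.IH(2) show ?case by (simp add: algebra_simps)
qed simp

lemma lang_iff_gen: "w \<in> lang G \<longleftrightarrow> (\<exists>h. gen G h [Nt (start G)] w)"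
proof
  assume "w \<in> lang G"
  then show "\<exists>h. gen G h [Nt (start G)] w"
    unfolding lang_def by (auto intro: derives_imp_gen)
next
  assume "\<exists>h. gen G h [Nt (start G)] w"
  then obtain h where h: "gen G h [Nt (start G)] w" ..
  \<comment> \<open>Finitely many productions have a common length bound, as
    \<open>gen_imp_derives\<close> demands.\<close>
  have "\<exists>c. \<forall>(A, \<beta>) \<in> set (prods G). length \<beta> \<le> c"
    using finite_nat_set_iff_bounded_le[of "(\<lambda>(A, \<beta>). length \<beta>) ` set (prods G)"] by force
  then obtain c where c: "\<And>A \<beta>. (A, \<beta>) \<in> set (prods G) \<Longrightarrow> length \<beta> \<le> c" by blast
  obtain k where "(derives1 G ^^ k) [Nt (start G)] (map Tm w)"
    using gen_imp_derives[OF _ h, of c] c by blast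
  then show "w \<in> lang G" unfolding lang_def by (auto intro: relpowp_imp_rtranclp)
qed

section \<open>Trees of least height and their longest paths\<close>

definition new :: "('n, 't) cfg \<Rightarrow> nat \<Rightarrow> 'n \<times> 't list \<Rightarrow> bool" where
  "new G h = (\<lambda>(A, w). gen G h [Nt A] w \<and> (\<forall>h' < h. \<not> gen G h' [Nt A] w))"

text \<open>\<open>(B, v)\<close> sits inside \<open>(A, w)\<close> in a replaceable way: this stands for \<open>B\<close> labelling a node below
  \<open>A\<close> in a derivation tree of \<open>w\<close>.\<close>

definition embeds :: "('n, 't) cfg \<Rightarrow> 'n \<times> 't list \<Rightarrow> 'n \<times> 't list \<Rightarrow> bool" where
  "embeds G = (\<lambda>(A, w) (B, v). \<exists>p q. w = p @ v @ q \<and>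
     (\<forall>v' k. gen G k [Nt B] v' \<longrightarrow> (\<exists>k'. gen G k' [Nt A] (p @ v' @ q))))"

lemma embeds_refl: "embeds G x x"
  unfolding embeds_def by (auto split: prod.split intro!: exI[of _ "[]"])

lemma embeds_trans:
  assumes "embeds G x y" "embeds G y z"
  shows "embeds G x z"
proof -
  obtain A u B v C w where xyz: "x = (A, u)" "y = (B, v)" "z = (C, w)" by (metis surj_pair)
  from assms(1) obtain p q where pq: "u = p @ v @ q"
    "\<And>v' k. gen G k [Nt B] v' \<Longrightarrow> \<exists>k'. gen G k' [Nt A] (p @ v' @ q)"
    unfolding xyz embeds_def by blast
  from assms(2) obtain r s where rs: "v = r @ w @ s"
    "\<And>v' k. gen G k [Nt C] v' \<Longrightarrow> \<exists>k'. gen G k' [Nt B] (r @ v' @ s)"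
    unfolding xyz embeds_def by blast
  have "u = (p @ r) @ w @ (s @ q)" using pq rs by simp
  moreover have "\<exists>k'. gen G k' [Nt A] ((p @ r) @ v' @ (s @ q))" if "gen G k [Nt C] v'" for v' k
    using rs(2)[OF that] pq(2) by fastforce
  ultimately show ?thesis unfolding xyz embeds_def prod.case by blast
qed

text \<open>If every root had a tree of height at most \<open>h\<close> for its factor of
  \<open>w\<close>, these trees would form a forest of height at most \<open>h\<close>. So some root
  \<open>B\<close> needs height \<open>Suc h\<close>, and its tree can be exchanged for any other
  tree with root \<open>B\<close>.\<close>

lemma gen_new_child:
  "gen G h' \<alpha> w \<Longrightarrow> h' = Suc h \<Longrightarrow> \<not> gen G h \<alpha> w \<Longrightarrow>
    \<exists>B v p q. w = p @ v @ q \<and> gen G (Suc h) [Nt B] v \<and> \<not> gen G h [Nt B] v \<and>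
      (\<forall>v' k. gen G k [Nt B] v' \<longrightarrow> (\<exists>k'. gen G k' \<alpha> (p @ v' @ q)))"
proof (induction rule: gen.induct)
  case (gen_Nil h')
  then show ?case by (auto intro: gen.gen_Nil)
next
  case (gen_Tm h' \<alpha> w a)
  then have "\<not> gen G h \<alpha> w" by (auto intro: gen.gen_Tm)
  with gen_Tm obtain B v p q where B: "w = p @ v @ q" "gen G (Suc h) [Nt B] v"
    "\<not> gen G h [Nt B] v" "\<And>v' k. gen G k [Nt B] v' \<Longrightarrow> \<exists>k'. gen G k' \<alpha> (p @ v' @ q)" by blast
  have "\<exists>k'. gen G k' (Tm a # \<alpha>) ((a # p) @ v' @ q)" if "gen G k [Nt B] v'" for v' k
    using B(4)[OF that] by (auto intro: gen.gen_Tm)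
  moreover have "a # w = (a # p) @ v @ q" using B(1) by simp
  ultimately show ?case using B(2,3) by blast
next
  case (gen_Nt A \<beta> h' u \<alpha> w)
  then have [simp]: "h' = h" by simp
  have A: "gen G (Suc h) [Nt A] u" using gen_Nt.hyps by (auto simp: gen_single_Nt_iff)
  show ?case
  proof (cases "gen G h [Nt A] u")
    case False
    have "\<exists>k'. gen G k' (Nt A # \<alpha>) ([] @ v' @ w)" if "gen G k [Nt A] v'" for v' k
    proof -
      have "gen G (max k (Suc h)) ([Nt A] @ \<alpha>) (v' @ w)"
        using gen_Nt.hyps(3) by (intro gen_append) (auto elim: gen_mono intro: gen_mono[OF that])
      then show ?thesis by auto
    qed
    moreover have "u @ w = [] @ u @ w" by simp
    ultimately show ?thesis using A False by blast
  next
    case True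
    have "\<not> gen G h \<alpha> w"
      using gen_append[OF True, of \<alpha> w] gen_Nt.prems(2) by auto
    with gen_Nt obtain B v p q where B: "w = p @ v @ q" "gen G (Suc h) [Nt B] v"
      "\<not> gen G h [Nt B] v" "\<And>v' k. gen G k [Nt B] v' \<Longrightarrow> \<exists>k'. gen G k' \<alpha> (p @ v' @ q)" by blast
    have "\<exists>k'. gen G k' (Nt A # \<alpha>) ((u @ p) @ v' @ q)" if v': "gen G k [Nt B] v'" for v' k
    proof -
      from B(4)[OF v'] obtain k' where k': "gen G k' \<alpha> (p @ v' @ q)" ..
      have "gen G (max (Suc h) k') ([Nt A] @ \<alpha>) (u @ (p @ v' @ q))"
        using A k' by (intro gen_append) (auto elim: gen_mono)
      then show ?thesis by auto
    qed
    moreover have "u @ w = (u @ p) @ v @ q" using B(1) by simp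
    ultimately show ?thesis using B(2,3) by blast
  qed
qed

text \<open>\<open>f i\<close> is the node at height \<open>i\<close> on a longest path of a tree of minimal height.\<close>

lemma new_imp_chain:
  "new G h x \<Longrightarrow> \<exists>f. f h = x \<and> (\<forall>i \<in> {1..h}. new G i (f i)) \<and>
     (\<forall>i j. 1 \<le> i \<and> i \<le> j \<and> j \<le> h \<longrightarrow> embeds G (f j) (f i))"
proof (induction h arbitrary: x)
  case 0
  then show ?case by (auto intro!: exI[of _ "\<lambda>_. x"])
next
  case (Suc h)
  obtain A w where x: "x = (A, w)" by fastforce
  show ?case
  proof (cases h)
    case 0
    with Suc.prems show ?thesis
      by (intro exI[of _ "\<lambda>_. x"]) (auto simp: embeds_refl le_Suc_eq)
  next
    case (Suc h')
    from Suc.prems obtain \<beta> where \<beta>: "(A, \<beta>) \<in> set (prods G)" "gen G h \<beta> w"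
      unfolding x new_def by (auto simp: gen_single_Nt_iff)
    have "\<not> gen G h' \<beta> w"
    proof
      assume "gen G h' \<beta> w"
      with \<beta>(1) have "gen G h [Nt A] w" using Suc by (auto simp: gen_single_Nt_iff)
      with Suc.prems show False unfolding x new_def by auto
    qed
    from gen_new_child[OF \<beta>(2) Suc this] obtain B v p q where B: "w = p @ v @ q"
      "gen G h [Nt B] v" "\<not> gen G h' [Nt B] v"
      "\<And>v' k. gen G k [Nt B] v' \<Longrightarrow> \<exists>k'. gen G k' \<beta> (p @ v' @ q)"
      unfolding Suc[symmetric] by blast
    have newB: "new G h (B, v)"
      unfolding new_def using B(2,3) Suc by (auto dest: gen_mono[of _ _ _ _ h'])
    have emb: "embeds G x (B, v)"
      unfolding x embeds_def prod.case
    proof (intro exI conjI allI impI)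
      show "w = p @ v @ q" by fact
      fix v' k assume "gen G k [Nt B] v'"
      from B(4)[OF this] obtain k' where "gen G k' \<beta> (p @ v' @ q)" ..
      \<comment> \<open>The witness for the height may not mention the obtained \<open>k'\<close>,
        hence the choice term.\<close>
      with \<beta>(1) show "gen G (Suc (SOME k'. gen G k' \<beta> (p @ v' @ q))) [Nt A] (p @ v' @ q)"
        by (auto simp: gen_single_Nt_iff intro: someI)
    qed
    from Suc.IH[OF newB] obtain f where f: "f h = (B, v)" "\<And>i. i \<in> {1..h} \<Longrightarrow> new G i (f i)"
      "\<And>i j. 1 \<le> i \<Longrightarrow> i \<le> j \<Longrightarrow> j \<le> h \<Longrightarrow> embeds G (f j) (f i)" by blast
    \<comment> \<open>The chain of the child is continued by \<open>x\<close> at the top;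
      transitivity relates \<open>x\<close> to all lower nodes.\<close>
    have "embeds G x (f i)" if "1 \<le> i" "i \<le> h" for i
      using embeds_trans[OF emb] f(3)[of i h] that f(1) by simp
    with f Suc.prems show ?thesis
      by (intro exI[of _ "f(Suc h := x)"]) (auto simp: embeds_refl le_Suc_eq)
  qed
qed

text \<open>With a common nonterminal, different least heights force different words, so the factor
  \<open>v\<close> of \<open>w\<close> is a proper one.\<close>

lemma embeds_new_neq:
  assumes "new G i (A, v)" "new G j (A, w)" "i < j" "embeds G (A, w) (A, v)"
  shows "length v < length w" "subseq v w"
proof -
  from assms(4) obtain p q where pq: "w = p @ v @ q" unfolding embeds_def by blast
  have "v \<noteq> w" using assms(1-3) unfolding new_def by auto
  then have "p @ q \<noteq> []" using pq by auto
  then show "length v < length w" unfolding pq by auto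
  show "subseq v w" unfolding pq by (intro subseq_drop_many subseq_rev_drop_many subseq_order.order_refl)
qed

section \<open>Pigeonhole on a longest path\<close>

lemma new_in_heads:
  assumes "new G i x"
  shows "fst x \<in> fst ` set (prods G)"
  using assms unfolding new_def by (force simp: gen_single_Nt_iff split: prod.splits)

lemma card_heads: "card (fst ` set (prods G)) \<le> length (prods G)"
  using card_image_le[of "set (prods G)" fst] card_length[of "prods G"] by simp

text \<open>Nonterminal and word length tell the nodes of the chain apart, because a repeated
  nonterminal forces strictly different lengths. The possible lengths are 0 up to
  \<open>length w\<close>, hence the factor \<open>Suc (length w)\<close>.\<close>

lemma new_height_bound:
  assumes "new G h (A, w)"
  shows "h \<le> length (prods G) * Suc (length w)"
proof -
  from new_imp_chain[OF assms] obtain f where f: "f h = (A, w)"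
    "\<And>i. i \<in> {1..h} \<Longrightarrow> new G i (f i)"
    "\<And>i j. 1 \<le> i \<Longrightarrow> i \<le> j \<Longrightarrow> j \<le> h \<Longrightarrow> embeds G (f j) (f i)" by blast
  define g where "g i = (fst (f i), length (snd (f i)))" for i
  have less: "g i \<noteq> g j" if "i \<in> {1..h}" "j \<in> {1..h}" "i < j" for i j
  proof
    assume eq: "g i = g j"
    then obtain B u v where uv: "f i = (B, u)" "f j = (B, v)" "length u = length v"
      unfolding g_def by (metis prod.collapse prod.inject)
    have "embeds G (f j) (f i)" using f(3)[of i j] that by simp
    then have "length u < length v"
      using embeds_new_neq(1)[of G i B u j v] f(2)[OF that(1)] f(2)[OF that(2)] that(3) uv by simp
    with uv(3) show False by simp
  qed
  have "inj_on g {1..h}"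
    by (rule inj_onI) (metis less linorder_neqE_nat)
  moreover have "g ` {1..h} \<subseteq> fst ` set (prods G) \<times> {..length w}"
  proof (rule image_subsetI)
    fix i assume i: "i \<in> {1..h}"
    from i f(3)[of i h] f(1) have "embeds G (A, w) (f i)" by auto
    then have "length (snd (f i)) \<le> length w" unfolding embeds_def by auto
    then show "g i \<in> fst ` set (prods G) \<times> {..length w}"
      using new_in_heads[OF f(2)[OF i]] unfolding g_def by auto
  qed
  ultimately have "card {1..h} \<le> card (fst ` set (prods G) \<times> {..length w})"
    by (intro card_inj_on_le[of g]) auto
  also have "\<dots> \<le> length (prods G) * Suc (length w)"
    using card_heads[of G] by (simp add: card_cartesian_product del: mult_Suc_right)
  finally show ?thesis by simp
qed

text \<open>A nonterminal \<open>B\<close> is repeated low on the chain, and its upper word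
  \<open>v\<close> is replaced by its lower one. This loses at most \<open>length v\<close> letters,
  and the low tree for \<open>v\<close> makes that loss boundable by
  \<open>gen_length\<close>.\<close>

lemma new_pump_down:
  assumes "new G h (A, w)" "length (prods G) < h"
  shows "\<exists>w' B v k. gen G k [Nt A] w' \<and> subseq w' w \<and> length w' < length w \<and>
    length w \<le> length w' + length v \<and> gen G (Suc (length (prods G))) [Nt B] v"
proof -
  from new_imp_chain[OF assms(1)] obtain f where f: "f h = (A, w)"
    "\<And>i. i \<in> {1..h} \<Longrightarrow> new G i (f i)"
    "\<And>i j. 1 \<le> i \<Longrightarrow> i \<le> j \<Longrightarrow> j \<le> h \<Longrightarrow> embeds G (f j) (f i)" by blast
  \<comment> \<open>One height more than there are productions, hence more than left-hand
    sides.\<close>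
  let ?I = "{1..Suc (length (prods G))}"
  have sub: "i \<in> {1..h}" if "i \<in> ?I" for i using that assms(2) by auto
  have "(fst \<circ> f) ` ?I \<subseteq> fst ` set (prods G)"
    using new_in_heads[OF f(2)[OF sub]] by auto
  then have "card ((fst \<circ> f) ` ?I) \<le> length (prods G)"
    using card_mono[of "fst ` set (prods G)"] card_heads[of G] le_trans by blast
  then have "\<not> inj_on (fst \<circ> f) ?I"
    using card_image[of "fst \<circ> f" ?I] by auto
  then obtain i j where ij: "i \<in> ?I" "j \<in> ?I" "i < j" "fst (f i) = fst (f j)"
    unfolding inj_on_def by (metis comp_apply linorder_neqE_nat)
  obtain B u v where uv: "f i = (B, u)" "f j = (B, v)" using ij(4) by (metis prod.collapse)
  have "embeds G (B, v) (B, u)" using f(3)[of i j] ij uv sub[OF ij(2)] by auto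
  then have uv': "length u < length v" "subseq u v"
    using embeds_new_neq[of G i B u j v] f(2)[OF sub[OF ij(1)]] f(2)[OF sub[OF ij(2)]] uv ij(3)
    by auto
  have "embeds G (A, w) (B, v)" using f(3)[of j h] f(1) ij uv sub[OF ij(2)] by auto
  then obtain p q where pq: "w = p @ v @ q"
    "\<And>v' k. gen G k [Nt B] v' \<Longrightarrow> \<exists>k'. gen G k' [Nt A] (p @ v' @ q)"
    unfolding embeds_def by blast
  have "gen G i [Nt B] u" "gen G j [Nt B] v"
    using f(2)[OF sub[OF ij(1)]] f(2)[OF sub[OF ij(2)]] uv unfolding new_def by auto
  moreover from this obtain k where "gen G k [Nt A] (p @ u @ q)" using pq(2) by blast
  moreover have "gen G (Suc (length (prods G))) [Nt B] v"
    using \<open>gen G j [Nt B] v\<close> ij(2) by (auto elim: gen_mono)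
  moreover have "subseq (p @ u @ q) w"
    unfolding pq(1) using uv'(2) by (intro list_emb_append_mono) auto
  ultimately show ?thesis using uv'(1) pq(1)
    by (intro exI[of _ "p @ u @ q"] exI[of _ B] exI[of _ v] exI[of _ k]) auto
qed

lemma gen_imp_new: "gen G h [Nt A] w \<Longrightarrow> \<exists>h' \<le> h. new G h' (A, w)"
  unfolding new_def
  by (intro exI[of _ "LEAST h. gen G h [Nt A] w"]) (auto intro: LeastI Least_le dest: not_less_Least)

text \<open>A shortest word that has no derivation tree of height at most the number of productions can
  be pumped down to a word with such a tree.\<close>

lemma not_subword_free_bounded:
  assumes c: "\<And>A \<beta>. (A, \<beta>) \<in> set (prods G) \<Longrightarrow> length \<beta> \<le> c" "length (prods G) \<le> c"
    and "\<not> subword_free (lang G)"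
  shows "\<exists>u w. subseq u w \<and> u \<noteq> w \<and> gen G (c * Suc (2 * (c + 2) ^ Suc c)) [Nt (start G)] u \<and>
    gen G (c * Suc (2 * (c + 2) ^ Suc c)) [Nt (start G)] w"
proof -
  let ?n = "length (prods G)" and ?S = "[Nt (start G)]"
  \<comment> \<open>Twice the bound of \<open>len\<close>: once for the pumped word
    \<open>w'\<close> and once for the factor \<open>v\<close> in which the cut is made.\<close>
  let ?l = "2 * (c + 2) ^ Suc c"
  have len: "length w \<le> (c + 2) ^ Suc c" if "gen G h [Nt A] w" "h \<le> Suc ?n" for A w h
  proof -
    have "length w \<le> (c + 2) ^ h" using gen_length[OF c(1) that(1)] by simp
    also have "\<dots> \<le> (c + 2) ^ Suc c" using that(2) c(2) by (intro power_increasing) auto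
    finally show ?thesis .
  qed
  \<comment> \<open>For words of bounded length the least height is bounded by
    \<open>new_height_bound\<close>, whatever tree put them into the language.\<close>
  have small: "gen G (c * Suc ?l) ?S w" if "w \<in> lang G" "length w \<le> ?l" for w
  proof -
    from that(1) obtain h where h: "new G h (start G, w)"
      using gen_imp_new unfolding lang_iff_gen by metis
    have "h \<le> ?n * Suc (length w)" by (rule new_height_bound[OF h])
    also have "\<dots> \<le> c * Suc ?l" using c(2) that(2) by (intro mult_le_mono) auto
    finally have "h \<le> c * Suc ?l" .
    with h show ?thesis unfolding new_def by (auto elim: gen_mono)
  qed
  show ?thesis
  proof (cases "\<forall>w \<in> lang G. gen G ?n ?S w")
    case True
    from assms(3) obtain u w where uw: "u \<in> lang G" "w \<in> lang G" "subseq u w" "u \<noteq> w"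
      unfolding subword_free_def by blast
    have "length x \<le> ?l" if "x \<in> lang G" for x
      using len[of ?n "start G" x] True that by fastforce
    then show ?thesis using uw small by blast
  next
    case False
    let ?Q = "\<lambda>w. w \<in> lang G \<and> \<not> gen G ?n ?S w"
    from False obtain w where w: "?Q w" "\<And>v. length v < length w \<Longrightarrow> \<not> ?Q v"
      using ex_has_least_nat[of ?Q _ length] by (metis leD)
    from w(1) obtain h where h: "new G h (start G, w)"
      using gen_imp_new unfolding lang_iff_gen by metis
    have "?n < h" using h w(1) unfolding new_def by (auto simp: not_le[symmetric] dest: gen_mono)
    from new_pump_down[OF h this] obtain w' B v k where w': "gen G k ?S w'" "subseq w' w"
      "length w' < length w" "length w \<le> length w' + length v" "gen G (Suc ?n) [Nt B] v" by blast
    have "w' \<in> lang G" using w'(1) lang_iff_gen by blast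
    \<comment> \<open>\<open>w'\<close> is shorter than \<open>w\<close>, a shortest word without a
      low tree.\<close>
    with w(2)[OF w'(3)] have "gen G ?n ?S w'" by blast
    then have "length w' \<le> (c + 2) ^ Suc c" by (rule len) simp
    moreover have "length v \<le> (c + 2) ^ Suc c" by (rule len[OF w'(5)]) simp
    ultimately have "length w' \<le> ?l" "length w \<le> ?l" using w'(4) by auto
    then show ?thesis using small w(1) \<open>w' \<in> lang G\<close> w'(2,3) by blast
  qed
qed

section \<open>Closure properties of computable functions\<close>

definition computable :: "nat \<Rightarrow> (nat list \<Rightarrow> nat) \<Rightarrow> bool" where
  "computable k F \<longleftrightarrow> (\<exists>r. \<forall>xs. length xs = k \<longrightarrow> computes r xs (F xs))"

definition decidable :: "nat \<Rightarrow> (nat list \<Rightarrow> bool) \<Rightarrow> bool" where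
  "decidable k P \<longleftrightarrow> computable k (\<lambda>xs. of_bool (P xs))"

named_theorems comp_intros

lemma computable_cong:
  "(\<And>xs. length xs = k \<Longrightarrow> F xs = F' xs) \<Longrightarrow> computable k F \<longleftrightarrow> computable k F'"
  unfolding computable_def by (metis (mono_tags, lifting))

lemma computable_comp:
  assumes "computable (length gs) F" "\<forall>g \<in> set gs. computable k g"
  shows "computable k (\<lambda>xs. F (map (\<lambda>g. g xs) gs))"
proof -
  from assms(1) obtain r where r: "\<And>xs. length xs = length gs \<Longrightarrow> computes r xs (F xs)"
    unfolding computable_def by blast
  from assms(2) obtain R where R: "\<forall>g \<in> set gs. \<forall>xs. length xs = k \<longrightarrow> computes (R g) xs (g xs)"
    unfolding computable_def by metis
  have "computes (Comp r (map R gs)) xs (F (map (\<lambda>g. g xs) gs))" if "length xs = k" for xs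
    by (rule computes.Comp[of _ _ "map (\<lambda>g. g xs) gs"])
      (use R r that in \<open>auto simp: list.rel_map intro!: list.rel_refl_strong\<close>)
  then show ?thesis unfolding computable_def by blast
qed

lemma computable_nth: "i < k \<Longrightarrow> computable k (\<lambda>xs. xs ! i)"
  unfolding computable_def using computes.Proj by metis

text \<open>In the closure rules, bound variables are pushed to the front of the argument list, so that the
  variable with de Bruijn index \<open>i\<close> is \<open>hd (tl (\<dots> (tl xs)))\<close> with \<open>i\<close> tails.\<close>

lemma computable_vars [comp_intros]:
  "computable (Suc k) (\<lambda>xs. hd xs)"
  "computable (Suc (Suc k)) (\<lambda>xs. hd (tl xs))"
  "computable (Suc (Suc (Suc k))) (\<lambda>xs. hd (tl (tl xs)))"
  "computable (Suc (Suc (Suc (Suc k)))) (\<lambda>xs. hd (tl (tl (tl xs))))"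
  "computable (Suc (Suc (Suc (Suc (Suc k))))) (\<lambda>xs. hd (tl (tl (tl (tl xs)))))"
  "computable (Suc (Suc (Suc (Suc (Suc (Suc k)))))) (\<lambda>xs. hd (tl (tl (tl (tl (tl xs))))))"
proof -
  have "computable k (\<lambda>xs. hd ((tl ^^ i) xs))" if "i < k" for i k
  proof -
    have "hd ((tl ^^ i) xs) = xs ! i" if "i < length xs" for xs :: "nat list"
      using that by (induction i arbitrary: xs) (auto simp: hd_conv_nth funpow_swap1 nth_tl)
    then show ?thesis using computable_nth[OF that] that
      by (subst computable_cong[of _ _ "\<lambda>xs. xs ! i"]) auto
  qed
  \<comment> \<open>Six variables occur at most, in \<open>cstep\<close>: three arguments under
    three nested quantifiers.\<close>
  from this[of 0] this[of 1] this[of 2] this[of 3] this[of 4] this[of 5]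
  show "computable (Suc k) (\<lambda>xs. hd xs)"
    "computable (Suc (Suc k)) (\<lambda>xs. hd (tl xs))"
    "computable (Suc (Suc (Suc k))) (\<lambda>xs. hd (tl (tl xs)))"
    "computable (Suc (Suc (Suc (Suc k)))) (\<lambda>xs. hd (tl (tl (tl xs))))"
    "computable (Suc (Suc (Suc (Suc (Suc k))))) (\<lambda>xs. hd (tl (tl (tl (tl xs)))))"
    "computable (Suc (Suc (Suc (Suc (Suc (Suc k)))))) (\<lambda>xs. hd (tl (tl (tl (tl (tl xs))))))"
    by (simp_all add: numeral_eq_Suc)
qed

text \<open>Lets a closure rule be proved for plain variables only; composition supplies arbitrary
  argument functions.\<close>

lemma computable_comp1:
  assumes "computable (Suc 0) (\<lambda>xs. f (hd xs))" "computable k a"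
  shows "computable k (\<lambda>xs. f (a xs))"
  using computable_comp[of "[a]" "\<lambda>xs. f (hd xs)" k] assms by simp

lemma computable_comp2:
  assumes "computable (Suc (Suc 0)) (\<lambda>xs. f (hd xs) (hd (tl xs)))" "computable k a" "computable k b"
  shows "computable k (\<lambda>xs. f (a xs) (b xs))"
  using computable_comp[of "[a, b]" "\<lambda>xs. f (hd xs) (hd (tl xs))" k] assms by simp

lemma decidable_comp2:
  assumes "decidable (Suc (Suc 0)) (\<lambda>xs. f (hd xs) (hd (tl xs)))" "computable k a" "computable k b"
  shows "decidable k (\<lambda>xs. f (a xs) (b xs))"
  using assms unfolding decidable_def by (rule computable_comp2)

lemma decidable_comp3:
  assumes "decidable (Suc (Suc (Suc 0))) (\<lambda>xs. f (hd xs) (hd (tl xs)) (hd (tl (tl xs))))"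
    "computable k a" "computable k b" "computable k c"
  shows "decidable k (\<lambda>xs. f (a xs) (b xs) (c xs))"
  using computable_comp[of "[a, b, c]" "\<lambda>xs. of_bool (f (hd xs) (hd (tl xs)) (hd (tl (tl xs))))" k] assms
  unfolding decidable_def by simp

section \<open>Arithmetic, logic and search\<close>

lemma computable_Suc [comp_intros]:
  assumes "computable k a"
  shows "computable k (\<lambda>xs. Suc (a xs))"
proof (rule computable_comp1[OF _ assms])
  show "computable (Suc 0) (\<lambda>xs. Suc (hd xs))"
    unfolding computable_def by (rule exI[of _ Succ]) (auto simp: length_Suc_conv intro: computes.Succ)
qed

lemma computable_const [comp_intros]: "computable k (\<lambda>xs. c)"
proof (induction c)
  case 0
  show ?case unfolding computable_def using computes.Zero by blast
next
  case (Suc c)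
  then show ?case by (rule computable_Suc)
qed

text \<open>Recursion acts on the first argument, so \<open>n xs\<close> has to be put in front of
  the tuple. Composition with \<open>n\<close> and the \<open>k\<close> projections does
  this.\<close>

lemma computable_subst:
  assumes "computable (Suc k) (\<lambda>ys. F (hd ys) (tl ys))" "computable k n"
  shows "computable k (\<lambda>xs. F (n xs) xs)"
proof -
  let ?gs = "n # map (\<lambda>i xs. xs ! i) [0..<k]"
  have "computable k (\<lambda>xs. F (hd (map (\<lambda>g. g xs) ?gs)) (tl (map (\<lambda>g. g xs) ?gs)))"
    by (rule computable_comp[of ?gs "\<lambda>ys. F (hd ys) (tl ys)"]) (use assms computable_nth in auto)
  then show ?thesis
    by (rule computable_cong[THEN iffD1, rotated]) (auto simp: comp_def map_nth)
qed

text \<open>Makes room for the previous value, which a recursion step receives between the counter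
  and the parameters and which \<open>F\<close> ignores.\<close>

lemma computable_weaken_second:
  assumes "computable (Suc k) (\<lambda>ys. F (hd ys) (tl ys))"
  shows "computable (Suc (Suc k)) (\<lambda>ys. F (hd ys) (tl (tl ys)))"
proof -
  let ?gs = "(\<lambda>ys. ys ! 0) # map (\<lambda>i ys. ys ! (i + 2)) [0..<k]"
  have "computable (Suc (Suc k)) (\<lambda>xs. F (hd (map (\<lambda>g. g xs) ?gs)) (tl (map (\<lambda>g. g xs) ?gs)))"
    by (rule computable_comp[of ?gs "\<lambda>ys. F (hd ys) (tl ys)"])
      (use assms computable_nth[of _ "Suc (Suc k)"] in auto)
  then show ?thesis
  proof (rule computable_cong[THEN iffD1, rotated])
    fix xs :: "nat list" assume "length xs = Suc (Suc k)"
    then obtain a b ys where "xs = a # b # ys" "length ys = k" by (auto simp: length_Suc_conv)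
    then show "F (hd (map (\<lambda>g. g xs) ?gs)) (tl (map (\<lambda>g. g xs) ?gs)) = F (hd xs) (tl (tl xs))"
      by (auto simp: comp_def map_nth)
  qed
qed

text \<open>The only direct use of \<open>PrimRec\<close>; arithmetic and bounded quantifiers are
  reduced to \<open>rec_nat\<close>.\<close>

lemma computable_rec_nat [comp_intros]:
  assumes "computable k a" "computable (Suc (Suc k)) (\<lambda>ys. b (hd ys) (hd (tl ys)) (tl (tl ys)))"
    "computable k n"
  shows "computable k (\<lambda>xs. rec_nat (a xs) (\<lambda>i y. b i y xs) (n xs))"
proof (rule computable_subst[OF _ assms(3)])
  from assms(1) obtain ra where ra: "\<And>xs. length xs = k \<Longrightarrow> computes ra xs (a xs)"
    unfolding computable_def by blast
  from assms(2) obtain rb where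
    rb: "\<And>ys. length ys = Suc (Suc k) \<Longrightarrow> computes rb ys (b (hd ys) (hd (tl ys)) (tl (tl ys)))"
    unfolding computable_def by blast
  have "computes (PrimRec ra rb) (m # xs) (rec_nat (a xs) (\<lambda>i y. b i y xs) m)"
    if "length xs = k" for xs m
  proof (induction m)
    case 0
    show ?case using computes.PrimRec_0[OF ra[OF that]] by simp
  next
    case (Suc m)
    have "computes rb (m # rec_nat (a xs) (\<lambda>i y. b i y xs) m # xs)
        (b m (rec_nat (a xs) (\<lambda>i y. b i y xs) m) xs)"
      using rb[of "m # rec_nat (a xs) (\<lambda>i y. b i y xs) m # xs"] that by simp
    then show ?case using computes.PrimRec_Suc[OF Suc] by simp
  qed
  then show "computable (Suc k) (\<lambda>ys. rec_nat (a (tl ys)) (\<lambda>i y. b i y (tl ys)) (hd ys))"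
    unfolding computable_def by (intro exI[of _ "PrimRec ra rb"]) (auto simp: length_Suc_conv)
qed

lemma computable_add [comp_intros]:
  assumes "computable k a" "computable k b"
  shows "computable k (\<lambda>xs. a xs + b xs)"
proof (rule computable_comp2[OF _ assms])
  have "rec_nat m (\<lambda>_ y. Suc y) n = m + n" for m n :: nat by (induction n) auto
  moreover have "computable (Suc (Suc 0)) (\<lambda>xs. rec_nat (hd xs) (\<lambda>_ y. Suc y) (hd (tl xs)))"
    by (intro comp_intros)
  ultimately show "computable (Suc (Suc 0)) (\<lambda>xs. hd xs + hd (tl xs))" by simp
qed

lemma computable_diff [comp_intros]:
  assumes "computable k a" "computable k b"
  shows "computable k (\<lambda>xs. a xs - b xs)"
proof (rule computable_comp2[OF _ assms])
  \<comment> \<open>Returning the counter yields the predecessor; iterating the predecessor yields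
    truncated subtraction.\<close>
  have "rec_nat 0 (\<lambda>i _. i) n = n - 1" for n by (cases n) auto
  moreover have "computable (Suc 0) (\<lambda>xs. rec_nat 0 (\<lambda>i _. i) (hd xs))" by (intro comp_intros)
  ultimately have pred: "computable (Suc 0) (\<lambda>xs. hd xs - 1)" by simp
  have "rec_nat m (\<lambda>_ y. y - 1) n = m - n" for m n :: nat by (induction n) auto
  moreover have "computable (Suc (Suc 0)) (\<lambda>xs. rec_nat (hd xs) (\<lambda>_ y. y - 1) (hd (tl xs)))"
    by (intro comp_intros computable_comp1[OF pred])
  ultimately show "computable (Suc (Suc 0)) (\<lambda>xs. hd xs - hd (tl xs))" by simp
qed

lemma computable_mult [comp_intros]:
  assumes "computable k a" "computable k b"
  shows "computable k (\<lambda>xs. a xs * b xs)"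
proof (rule computable_comp2[OF _ assms])
  have "rec_nat 0 (\<lambda>_ y. y + m) n = m * n" for m n :: nat by (induction n) auto
  moreover have "computable (Suc (Suc 0)) (\<lambda>xs. rec_nat 0 (\<lambda>_ y. y + hd xs) (hd (tl xs)))"
    by (intro comp_intros)
  ultimately show "computable (Suc (Suc 0)) (\<lambda>xs. hd xs * hd (tl xs))" by simp
qed

lemma computable_power [comp_intros]:
  assumes "computable k a" "computable k b"
  shows "computable k (\<lambda>xs. a xs ^ b xs)"
proof (rule computable_comp2[OF _ assms])
  have "rec_nat 1 (\<lambda>_ y. y * m) n = m ^ n" for m n :: nat by (induction n) auto
  moreover have "computable (Suc (Suc 0)) (\<lambda>xs. rec_nat 1 (\<lambda>_ y. y * hd xs) (hd (tl xs)))"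
    by (intro comp_intros)
  ultimately show "computable (Suc (Suc 0)) (\<lambda>xs. hd xs ^ hd (tl xs))" by simp
qed

lemma decidable_not [comp_intros]:
  "decidable k P \<Longrightarrow> decidable k (\<lambda>xs. \<not> P xs)"
proof -
  assume "decidable k P"
  then have "computable k (\<lambda>xs. 1 - of_bool (P xs))"
    unfolding decidable_def by (intro computable_diff computable_const)
  moreover have "of_bool (\<not> P xs) = (1 - of_bool (P xs) :: nat)" for xs by simp
  ultimately show ?thesis unfolding decidable_def by simp
qed

lemma decidable_conj [comp_intros]:
  "decidable k P \<Longrightarrow> decidable k Q \<Longrightarrow> decidable k (\<lambda>xs. P xs \<and> Q xs)"
  using computable_mult unfolding decidable_def by (simp add: of_bool_conj)

lemma decidable_disj [comp_intros]:
  assumes "decidable k P" "decidable k Q"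
  shows "decidable k (\<lambda>xs. P xs \<or> Q xs)"
proof -
  have "decidable k (\<lambda>xs. \<not> (\<not> P xs \<and> \<not> Q xs))" by (intro comp_intros assms)
  then show ?thesis by simp
qed

lemma decidable_le [comp_intros]:
  assumes "computable k a" "computable k b"
  shows "decidable k (\<lambda>xs. a xs \<le> b xs)"
proof -
  have "of_bool (m \<le> n) = 1 - (m - n)" for m n :: nat by auto
  moreover have "computable k (\<lambda>xs. 1 - (a xs - b xs))" by (intro comp_intros assms)
  ultimately show ?thesis unfolding decidable_def by simp
qed

lemma decidable_less [comp_intros]:
  "computable k a \<Longrightarrow> computable k b \<Longrightarrow> decidable k (\<lambda>xs. a xs < b xs)"
  using decidable_le[OF computable_Suc] by (simp add: Suc_le_eq)

lemma decidable_eq [comp_intros]: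
  assumes "computable k a" "computable k b"
  shows "decidable k (\<lambda>xs. a xs = b xs)"
proof -
  have "decidable k (\<lambda>xs. a xs \<le> b xs \<and> b xs \<le> a xs)" by (intro comp_intros assms)
  then show ?thesis by (simp add: order_eq_iff)
qed

lemma computable_if [comp_intros]:
  assumes "decidable k P" "computable k a" "computable k b"
  shows "computable k (\<lambda>xs. if P xs then a xs else b xs)"
proof -
  have "(if p then m else n) = of_bool p * m + (1 - of_bool p) * n" for p and m n :: nat by simp
  moreover have "computable k (\<lambda>xs. of_bool (P xs) * a xs + (1 - of_bool (P xs)) * b xs)"
    using assms unfolding decidable_def by (intro comp_intros)
  ultimately show ?thesis by simp
qed

text \<open>Bounded search as primitive recursion: the accumulator turns to 1 once a witness has
  been met and stays there.\<close>

lemma decidable_bex [comp_intros]: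
  assumes "decidable (Suc k) (\<lambda>ys. P (hd ys) (tl ys))" "computable k n"
  shows "decidable k (\<lambda>xs. \<exists>i < n xs. P i xs)"
proof -
  have "rec_nat 0 (\<lambda>i y :: nat. of_bool (0 < y \<or> P i xs)) m = of_bool (\<exists>i < m. P i xs)" for m xs
    by (induction m) (auto simp: less_Suc_eq)
  moreover have "decidable (Suc (Suc k)) (\<lambda>ys. P (hd ys) (tl (tl ys)))"
    using computable_weaken_second[where F = "\<lambda>i xs. of_bool (P i xs)"] assms(1)
    unfolding decidable_def .
  then have "decidable (Suc (Suc k)) (\<lambda>ys. 0 < hd (tl ys) \<or> P (hd ys) (tl (tl ys)))"
    by (intro decidable_disj decidable_less computable_const computable_vars)
  then have "computable k (\<lambda>xs. rec_nat 0 (\<lambda>i y. of_bool (0 < y \<or> P i xs)) (n xs))"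
    by (intro computable_rec_nat[where b = "\<lambda>i y xs. of_bool (0 < y \<or> P i xs)"]
        computable_const assms(2)) (simp add: decidable_def)
  ultimately show ?thesis unfolding decidable_def by simp
qed

lemma decidable_ball [comp_intros]:
  assumes "decidable (Suc k) (\<lambda>ys. P (hd ys) (tl ys))" "computable k n"
  shows "decidable k (\<lambda>xs. \<forall>i < n xs. P i xs)"
proof -
  have "decidable k (\<lambda>xs. \<not> (\<exists>i < n xs. \<not> P i xs))" by (intro comp_intros assms)
  then show ?thesis by simp
qed

text \<open>\<open>Mu\<close> looks for a zero, hence the program for the negation of
  \<open>P\<close>. Its value is 1 below the minimum, as \<open>Mu\<close> demands.\<close>

lemma computable_Least:
  assumes "decidable (Suc k) (\<lambda>ys. P (hd ys) (tl ys))" "\<And>xs. length xs = k \<Longrightarrow> \<exists>n. P n xs"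
  shows "computable k (\<lambda>xs. LEAST n. P n xs)"
proof -
  from decidable_not[OF assms(1)] obtain r where
    r: "\<And>ys. length ys = Suc k \<Longrightarrow> computes r ys (of_bool (\<not> P (hd ys) (tl ys)))"
    unfolding decidable_def computable_def by blast
  have "computes (Mu r) xs (LEAST n. P n xs)" if "length xs = k" for xs
  proof (rule computes.Mu)
    have "P (LEAST n. P n xs) xs" using assms(2)[OF that] by (rule LeastI_ex)
    then show "computes r ((LEAST n. P n xs) # xs) 0"
      using r[of "(LEAST n. P n xs) # xs"] that by simp
    fix m assume "m < (LEAST n. P n xs)"
    then have "\<not> P m xs" by (rule not_less_Least)
    then show "\<exists>y. computes r (m # xs) (Suc y)" using r[of "m # xs"] that by auto
  qed
  then show ?thesis unfolding computable_def by blast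
qed

section \<open>The pairing function and its inverse\<close>

lemma computable_prod_encode [comp_intros]:
  assumes "computable k a" "computable k b"
  shows "computable k (\<lambda>xs. prod_encode (a xs, b xs))"
proof (rule computable_comp2[OF _ assms])
  have "rec_nat 0 (\<lambda>i y. y + Suc i) n = triangle n" for n by (induction n) auto
  moreover have "computable (Suc (Suc 0)) (\<lambda>xs. rec_nat 0 (\<lambda>i y. y + Suc i) (hd xs + hd (tl xs)) + hd xs)"
    by (intro comp_intros)
  ultimately show "computable (Suc (Suc 0)) (\<lambda>xs. prod_encode (hd xs, hd (tl xs)))"
    by (simp add: prod_encode_def)
qed

text \<open>Decoding by search: an unbounded one for the first component, a bounded one for the
  second, which cannot exceed the code.\<close>

lemma computable_fst_prod_decode [comp_intros]:
  assumes "computable k a"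
  shows "computable k (\<lambda>xs. fst (prod_decode (a xs)))"
proof (rule computable_comp1[OF _ assms])
  have ex: "\<exists>b < Suc z. prod_encode (fst (prod_decode z), b) = z" for z
    using le_prod_encode_2[of "snd (prod_decode z)" "fst (prod_decode z)"]
    by (intro exI[of _ "snd (prod_decode z)"]) (simp add: less_Suc_eq_le)
  have "(LEAST a. \<exists>b < Suc z. prod_encode (a, b) = z) = fst (prod_decode z)" for z
    by (rule Least_equality) (use ex in auto)
  moreover have "computable (Suc 0) (\<lambda>xs. LEAST a. \<exists>b < Suc (hd xs). prod_encode (a, b) = hd xs)"
    by (intro computable_Least comp_intros) (use ex in blast)
  ultimately show "computable (Suc 0) (\<lambda>xs. fst (prod_decode (hd xs)))" by simp
qed

lemma computable_snd_prod_decode [comp_intros]: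
  assumes "computable k a"
  shows "computable k (\<lambda>xs. snd (prod_decode (a xs)))"
proof (rule computable_comp1[OF _ assms])
  have "(LEAST b. prod_encode (fst (prod_decode z), b) = z) = snd (prod_decode z)" for z
    by (rule Least_equality) (auto, metis prod_encode_inverse snd_conv order_refl)
  moreover have "computable (Suc 0) (\<lambda>xs. LEAST b. prod_encode (fst (prod_decode (hd xs)), b) = hd xs)"
    by (intro computable_Least comp_intros) (metis prod.collapse prod_decode_inverse)
  ultimately show "computable (Suc 0) (\<lambda>xs. snd (prod_decode (hd xs)))" by simp
qed

section \<open>Codes of lists and the subword test\<close>

text \<open>List operations on codes; past the end of a list, \<open>chd\<close> and \<open>cnth\<close> return \<open>0\<close>.\<close>

definition chd :: "nat \<Rightarrow> nat" where "chd z = fst (prod_decode (z - 1))"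
definition ctl :: "nat \<Rightarrow> nat" where "ctl z = snd (prod_decode (z - 1))"
definition cdrop :: "nat \<Rightarrow> nat \<Rightarrow> nat" where "cdrop z i = rec_nat z (\<lambda>_ y. ctl y) i"
definition cnth :: "nat \<Rightarrow> nat \<Rightarrow> nat" where "cnth z i = chd (cdrop z i)"
definition clen :: "nat \<Rightarrow> nat" where "clen z = (LEAST i. cdrop z i = 0)"

lemma chd_list_encode [simp]: "chd (list_encode (x # xs)) = x"
  by (simp add: chd_def)

lemma ctl_list_encode [simp]: "ctl (list_encode xs) = list_encode (tl xs)"
proof -
  \<comment> \<open>For the empty list: its code is 0, truncated \<open>0 - 1\<close> is 0, and so
    \<open>ctl 0\<close> is again 0.\<close>
  have "prod_decode 0 = (0, 0)" using prod_encode_inverse[of "(0, 0)"] by (simp add: prod_encode_def)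
  then show ?thesis by (cases xs) (simp_all add: ctl_def)
qed

lemma cdrop_list_encode [simp]: "cdrop (list_encode xs) i = list_encode (drop i xs)"
  by (induction i) (simp_all add: cdrop_def drop_Suc tl_drop)

lemma cnth_list_encode [simp]: "i < length xs \<Longrightarrow> cnth (list_encode xs) i = xs ! i"
  by (simp add: cnth_def del: list_encode.simps flip: Cons_nth_drop_Suc)

lemma list_encode_eq_0_iff [simp]: "list_encode xs = 0 \<longleftrightarrow> xs = []"
  by (cases xs) auto

lemma clen_list_encode [simp]: "clen (list_encode xs) = length xs"
  unfolding clen_def by (rule Least_equality) auto

lemma computable_chd [comp_intros]: "computable k a \<Longrightarrow> computable k (\<lambda>xs. chd (a xs))"
  unfolding chd_def by (intro comp_intros)

lemma computable_ctl [comp_intros]: "computable k a \<Longrightarrow> computable k (\<lambda>xs. ctl (a xs))"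
  unfolding ctl_def by (intro comp_intros)

lemma computable_cdrop [comp_intros]:
  "computable k a \<Longrightarrow> computable k b \<Longrightarrow> computable k (\<lambda>xs. cdrop (a xs) (b xs))"
  unfolding cdrop_def by (intro comp_intros)

lemma computable_cnth [comp_intros]:
  "computable k a \<Longrightarrow> computable k b \<Longrightarrow> computable k (\<lambda>xs. cnth (a xs) (b xs))"
  unfolding cnth_def by (intro comp_intros)

lemma computable_clen [comp_intros]:
  assumes "computable k a"
  shows "computable k (\<lambda>xs. clen (a xs))"
proof (rule computable_comp1[OF _ assms])
  \<comment> \<open>Every number codes a list, so the search for the length always ends.\<close>
  have "\<exists>n. cdrop z n = 0" for z
    using cdrop_list_encode[of "list_decode z" "length (list_decode z)"] by auto
  then show "computable (Suc 0) (\<lambda>xs. clen (hd xs))"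
    unfolding clen_def by (intro computable_Least comp_intros)
qed

text \<open>Greedy matching: scan \<open>w\<close> and strip from \<open>u\<close> each letter as soon as it is met.\<close>

definition csubseq :: "nat \<Rightarrow> nat \<Rightarrow> bool" where
  "csubseq u w \<longleftrightarrow>
     rec_nat u (\<lambda>i r. if r \<noteq> 0 \<and> chd r = cnth w i then ctl r else r) (clen w) = 0"

lemma decidable_csubseq [comp_intros]:
  assumes "computable k a" "computable k b"
  shows "decidable k (\<lambda>xs. csubseq (a xs) (b xs))"
  by (rule decidable_comp2[where f = csubseq, OF _ assms], unfold csubseq_def, intro comp_intros)

text \<open>Greedy matching is optimal: if the first letters agree, matching them loses nothing, and
  otherwise the letter of \<open>w\<close> has to be skipped.\<close>

lemma foldl_greedy_subseq:
  "foldl (\<lambda>r a. if r \<noteq> [] \<and> hd r = a then tl r else r) u w = [] \<longleftrightarrow> subseq u w"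
proof (induction w arbitrary: u)
  case (Cons a w)
  then show ?case by (cases u) auto
qed (auto dest: list_emb_Nil2)

lemma csubseq_list_encode [simp]: "csubseq (list_encode u) (list_encode w) \<longleftrightarrow> subseq u w"
proof -
  let ?g = "\<lambda>r a :: nat. if r \<noteq> [] \<and> hd r = a then tl r else r"
  let ?h = "\<lambda>i r. if r \<noteq> 0 \<and> chd r = cnth (list_encode w) i then ctl r else r"
  \<comment> \<open>Invariant: after \<open>i\<close> rounds the accumulator codes what the first
    \<open>i\<close> letters of \<open>w\<close> have left of \<open>u\<close>.\<close>
  have "rec_nat (list_encode u) ?h i = list_encode (foldl ?g u (take i w))" if "i \<le> length w" for i
    using that
  proof (induction i)
    case (Suc i)
    let ?r = "foldl ?g u (take i w)"
    have "?h i (list_encode ?r) = list_encode (?g ?r (w ! i))"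
      using Suc.prems by (cases ?r) (auto simp del: list_encode.simps)
    moreover have "rec_nat (list_encode u) ?h (Suc i) = ?h i (list_encode ?r)"
      using Suc by (simp only: nat.rec)
    moreover have "foldl ?g u (take (Suc i) w) = ?g ?r (w ! i)"
      using Suc.prems by (simp only: take_Suc_conv_app_nth Suc_le_eq foldl_append foldl.simps)
    ultimately show ?case by (simp only:)
  qed simp
  then show ?thesis unfolding csubseq_def by (simp add: foldl_greedy_subseq)
qed

section \<open>Size bounds for codes\<close>

lemma prod_encode_mono: "a \<le> a' \<Longrightarrow> b \<le> b' \<Longrightarrow> prod_encode (a, b) \<le> prod_encode (a', b')"
proof -
  have "mono triangle" by (rule mono_iff_le_Suc[THEN iffD2]) simp
  then show "a \<le> a' \<Longrightarrow> b \<le> b' \<Longrightarrow> ?thesis"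
    unfolding prod_encode_def by (auto intro!: add_mono dest: monoD)
qed

text \<open>The code of the list of \<open>n\<close> copies of \<open>m\<close>.\<close>

definition list_code_bound :: "nat \<Rightarrow> nat \<Rightarrow> nat" where
  "list_code_bound n m = rec_nat 0 (\<lambda>_ y. Suc (prod_encode (m, y))) n"

lemma computable_list_code_bound [comp_intros]:
  "computable k a \<Longrightarrow> computable k b \<Longrightarrow> computable k (\<lambda>xs. list_code_bound (a xs) (b xs))"
  by (rule computable_comp2[where f = list_code_bound]) (unfold list_code_bound_def, intro comp_intros)

lemma list_encode_le_list_code_bound:
  "length xs \<le> n \<Longrightarrow> (\<And>x. x \<in> set xs \<Longrightarrow> x \<le> m) \<Longrightarrow> list_encode xs \<le> list_code_bound n m"
proof (induction xs arbitrary: n)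
  case (Cons x xs)
  then obtain n' where "n = Suc n'" "length xs \<le> n'" by (cases n) auto
  with Cons show ?case by (simp add: list_code_bound_def prod_encode_mono)
qed simp

lemma member_le_list_encode: "x \<in> set xs \<Longrightarrow> x \<le> list_encode xs"
  by (induction xs) (auto intro: le_trans[OF _ le_SucI] le_prod_encode_1 le_prod_encode_2 le_trans)

lemma length_le_list_encode: "length xs \<le> list_encode xs"
  by (induction xs) (auto intro: le_trans le_prod_encode_2)

section \<open>Coded derivations\<close>

abbreviation enc :: "(nat, nat) sym list \<Rightarrow> nat" where
  "enc \<xi> \<equiv> list_encode (map sym_encode \<xi>)"

lemma inj_sym_encode: "inj sym_encode"
proof (rule injI)
  fix x y assume "sym_encode x = sym_encode y"
  then show "x = y"
    by (cases x; cases y)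
      (simp_all only: sym_encode.simps sum_encode_eq sum.inject sum.distinct)
qed

section \<open>Rewriting steps on codes\<close>

lemma sym_encode_simps: "sym_encode (Nt A) = 2 * A" "sym_encode (Tm a) = Suc (2 * a)"
  by (simp_all add: sum_encode_def)

text \<open>Describes the replacement of entry \<open>j\<close> position by position, so that on
  codes only lengths, entries and bounded quantifiers occur. Behind the inserted block positions
  shift by \<open>length as - 1\<close>, as one entry disappears.\<close>

lemma replace_nth_iff:
  assumes "j < length xs"
  shows "ys = take j xs @ as @ drop (Suc j) xs \<longleftrightarrow>
    Suc (length ys) = length xs + length as \<and>
    (\<forall>k < length ys. ys ! k = (if k < j then xs ! k else if k < j + length as then as ! (k - j)
       else xs ! (Suc k - length as)))"
    (is "_ = ?zs \<longleftrightarrow> _ \<and> (\<forall>k < _. _ = ?f k)")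
proof -
  have len: "Suc (length ?zs) = length xs + length as" using assms by simp
  have nth: "?zs ! k = ?f k" if "k < length ?zs" for k
    using that assms by (auto simp: nth_append min_def intro!: arg_cong[of _ _ "(!) xs"])
  show ?thesis
  proof (intro iffI conjI allI impI)
    assume "Suc (length ys) = length xs + length as \<and> (\<forall>k < length ys. ys ! k = ?f k)"
    then have ys: "Suc (length ys) = length xs + length as" "\<And>k. k < length ys \<Longrightarrow> ys ! k = ?f k"
      by blast+
    from ys(1) len have leq: "length ys = length ?zs" by linarith
    show "ys = ?zs"
    proof (rule nth_equalityI[OF leq])
      show "ys ! k = ?zs ! k" if "k < length ys" for k
        using ys(2)[OF that] nth[of k] that leq by (simp only:)
    qed
  qed (use len nth in simp_all)
qed

text \<open>\<open>i\<close> selects the production in \<open>P\<close> and \<open>j\<close> the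
  rewritten position; \<open>2 * A\<close> is the code of \<open>Nt A\<close>. The rest is the
  right-hand side of \<open>replace_nth_iff\<close>.\<close>

definition cstep :: "nat \<Rightarrow> nat \<Rightarrow> nat \<Rightarrow> bool" where
  "cstep P x y \<longleftrightarrow> (\<exists>i < clen P. \<exists>j < clen x.
     cnth x j = 2 * fst (prod_decode (cnth P i)) \<and>
     Suc (clen y) = clen x + clen (snd (prod_decode (cnth P i))) \<and>
     (\<forall>k < clen y. cnth y k =
       (if k < j then cnth x k
        else if k < j + clen (snd (prod_decode (cnth P i)))
        then cnth (snd (prod_decode (cnth P i))) (k - j)
        else cnth x (Suc k - clen (snd (prod_decode (cnth P i)))))))"

lemma decidable_cstep [comp_intros]:
  "computable k a \<Longrightarrow> computable k b \<Longrightarrow> computable k c \<Longrightarrow>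
    decidable k (\<lambda>xs. cstep (a xs) (b xs) (c xs))"
  by (rule decidable_comp3[where f = cstep]) (unfold cstep_def, intro comp_intros)

abbreviation prods_code :: "(nat, nat) cfg \<Rightarrow> nat" where
  "prods_code G \<equiv> list_encode (map prod_rule_encode (prods G))"

lemma cstep_replace_iff:
  "cstep (prods_code G) (enc \<xi>) (list_encode ys) \<longleftrightarrow>
    (\<exists>(A, \<alpha>) \<in> set (prods G). \<exists>j < length \<xi>. \<xi> ! j = Nt A \<and>
      ys = map sym_encode (take j \<xi> @ \<alpha> @ drop (Suc j) \<xi>))"
proof -
  let ?xs = "map sym_encode \<xi>"
  have "cstep (prods_code G) (enc \<xi>) (list_encode ys) \<longleftrightarrow>
    (\<exists>i < length (prods G). \<exists>j < length ?xs. ?xs ! j = 2 * fst (prods G ! i) \<and>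
      ys = take j ?xs @ map sym_encode (snd (prods G ! i)) @ drop (Suc j) ?xs)"
    unfolding cstep_def clen_list_encode length_map
  proof (intro ex_cong1 conj_cong refl)
    fix i j assume ij: "i < length (prods G)" "j < length \<xi>"
    have "fst (prod_decode (cnth (prods_code G) i)) = fst (prods G ! i)"
      and as: "snd (prod_decode (cnth (prods_code G) i)) = enc (snd (prods G ! i))"
      using ij by (simp_all add: prod_rule_encode_def)
    then show "cnth (enc \<xi>) j = 2 * fst (prod_decode (cnth (prods_code G) i)) \<longleftrightarrow>
        ?xs ! j = 2 * fst (prods G ! i)" using ij by simp
    let ?as = "map sym_encode (snd (prods G ! i))"
    \<comment> \<open>\<open>cnth\<close> agrees with list indexing only inside the list; the length
      equation keeps the index there.\<close>
    have "cnth (enc \<xi>) (Suc k - length ?as) = ?xs ! (Suc k - length ?as)"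
      if "Suc (length ys) = length \<xi> + length ?as" "k < length ys" for k
    proof (rule cnth_list_encode)
      show "Suc k - length ?as < length (map sym_encode \<xi>)"
        using that ij(2) unfolding length_map by arith
    qed
    then show "Suc (length ys) = length \<xi> + clen (snd (prod_decode (cnth (prods_code G) i))) \<and>
        (\<forall>k < length ys. cnth (list_encode ys) k =
          (if k < j then cnth (enc \<xi>) k
           else if k < j + clen (snd (prod_decode (cnth (prods_code G) i)))
           then cnth (snd (prod_decode (cnth (prods_code G) i))) (k - j)
           else cnth (enc \<xi>) (Suc k - clen (snd (prod_decode (cnth (prods_code G) i)))))) \<longleftrightarrow>
      ys = take j ?xs @ ?as @ drop (Suc j) ?xs"
      using ij unfolding as clen_list_encode
      by (subst replace_nth_iff) (auto cong: conj_cong)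
  qed
  also have "\<dots> \<longleftrightarrow> (\<exists>(A, \<alpha>) \<in> set (prods G). \<exists>j < length ?xs. ?xs ! j = 2 * A \<and>
      ys = take j ?xs @ map sym_encode \<alpha> @ drop (Suc j) ?xs)"
    unfolding case_prod_beta by (metis in_set_conv_nth)
  also have "\<dots> \<longleftrightarrow> (\<exists>(A, \<alpha>) \<in> set (prods G). \<exists>j < length \<xi>. \<xi> ! j = Nt A \<and>
      ys = map sym_encode (take j \<xi> @ \<alpha> @ drop (Suc j) \<xi>))"
  proof -
    have "?xs ! j = 2 * A \<longleftrightarrow> \<xi> ! j = Nt A" if "j < length \<xi>" for j A
      unfolding sym_encode_simps(1)[symmetric] nth_map[OF that] inj_eq[OF inj_sym_encode] ..
    then show ?thesis unfolding map_append take_map drop_map length_map by (simp cong: conj_cong)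
  qed
  finally show ?thesis .
qed

text \<open>An arbitrary number \<open>y\<close> codes some list, and a successor of a coded
  sentential form is again one. So being such a code propagates along a derivation.\<close>

lemma cstep_iff: "cstep (prods_code G) (enc \<xi>) y \<longleftrightarrow> (\<exists>\<eta>. y = enc \<eta> \<and> derives1 G \<xi> \<eta>)"
proof -
  have derives1_iff: "derives1 G \<xi> \<eta> \<longleftrightarrow> (\<exists>(A, \<alpha>) \<in> set (prods G). \<exists>j < length \<xi>. \<xi> ! j = Nt A \<and>
      \<eta> = take j \<xi> @ \<alpha> @ drop (Suc j) \<xi>)" for \<eta>
  proof
    assume "derives1 G \<xi> \<eta>"
    then show "\<exists>(A, \<alpha>) \<in> set (prods G). \<exists>j < length \<xi>. \<xi> ! j = Nt A \<and>
      \<eta> = take j \<xi> @ \<alpha> @ drop (Suc j) \<xi>"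
    proof cases
      case (1 A \<alpha> u v)
      then show ?thesis by (intro bexI[of _ "(A, \<alpha>)"]) (auto intro!: exI[of _ "length u"])
    qed
  next
    assume "\<exists>(A, \<alpha>) \<in> set (prods G). \<exists>j < length \<xi>. \<xi> ! j = Nt A \<and>
      \<eta> = take j \<xi> @ \<alpha> @ drop (Suc j) \<xi>"
    then obtain A \<alpha> j where j: "(A, \<alpha>) \<in> set (prods G)" "j < length \<xi>" "\<xi> ! j = Nt A"
      "\<eta> = take j \<xi> @ \<alpha> @ drop (Suc j) \<xi>" by blast
    have "\<xi> = take j \<xi> @ [Nt A] @ drop (Suc j) \<xi>"
      using id_take_nth_drop[OF j(2)] j(3) by simp
    with derives1.intros[OF j(1), of "take j \<xi>" "drop (Suc j) \<xi>"] j(4) show "derives1 G \<xi> \<eta>"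
      by simp
  qed
  have "cstep (prods_code G) (enc \<xi>) (list_encode (list_decode y)) \<longleftrightarrow>
      (\<exists>\<eta>. list_decode y = map sym_encode \<eta> \<and> derives1 G \<xi> \<eta>)"
    unfolding cstep_replace_iff derives1_iff by blast
  moreover have "list_decode y = xs \<longleftrightarrow> y = list_encode xs" for xs by auto
  ultimately show ?thesis by simp
qed

section \<open>Derivations as lists of codes\<close>

definition clast :: "nat \<Rightarrow> nat" where "clast d = cnth d (clen d - 1)"

lemma computable_clast [comp_intros]: "computable k a \<Longrightarrow> computable k (\<lambda>xs. clast (a xs))"
  unfolding clast_def by (intro comp_intros)

text \<open>\<open>d\<close> codes the list of sentential forms of a derivation of a terminal word (terminals have odd
  codes) in the grammar with code \<open>c\<close>.\<close>

definition cderivation :: "nat \<Rightarrow> nat \<Rightarrow> bool" where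
  "cderivation c d \<longleftrightarrow> 0 < clen d \<and>
     cnth d 0 = Suc (prod_encode (2 * cnth c 3, 0)) \<and>
     (\<forall>i < clen d - 1. cstep (cnth c 2) (cnth d i) (cnth d (Suc i))) \<and>
     (\<forall>j < clen (clast d). \<exists>q < cnth (clast d) j. cnth (clast d) j = Suc (2 * q))"

lemma decidable_cderivation [comp_intros]:
  "computable k a \<Longrightarrow> computable k b \<Longrightarrow> decidable k (\<lambda>xs. cderivation (a xs) (b xs))"
  by (rule decidable_comp2[where f = cderivation]) (unfold cderivation_def, intro comp_intros)

lemma cnth_cfg_encode:
  "cnth (cfg_encode G) 2 = prods_code G" "cnth (cfg_encode G) 3 = start G"
  unfolding cfg_encode_def by (subst cnth_list_encode; simp add: numeral_eq_Suc)+

lemma cderivation_imp_lang: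
  assumes "cderivation (cfg_encode G) d"
  shows "\<exists>w \<in> lang G. clast d = enc (map Tm w)"
proof -
  \<comment> \<open>The first entry in \<open>cderivation\<close> is the code of a one-element list,
    namely of the start symbol.\<close>
  have d: "0 < clen d" "cnth d 0 = enc [Nt (start G)]"
    "\<And>i. i < clen d - 1 \<Longrightarrow> cstep (prods_code G) (cnth d i) (cnth d (Suc i))"
    "\<And>j. j < clen (clast d) \<Longrightarrow> \<exists>q. cnth (clast d) j = Suc (2 * q)"
    using assms unfolding cderivation_def cnth_cfg_encode
    by (auto simp: sum_encode_def)
  have "\<exists>\<xi>. cnth d i = enc \<xi> \<and> (derives1 G)\<^sup>*\<^sup>* [Nt (start G)] \<xi>" if "i < clen d" for i
    using that
  proof (induction i)
    case 0
    then show ?case using d(2) by blast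
  next
    case (Suc i)
    then obtain \<xi> where \<xi>: "cnth d i = enc \<xi>" "(derives1 G)\<^sup>*\<^sup>* [Nt (start G)] \<xi>" by auto
    from Suc.prems have "i < clen d - 1" by linarith
    from d(3)[OF this] obtain \<eta> where "cnth d (Suc i) = enc \<eta>" "derives1 G \<xi> \<eta>"
      unfolding \<xi>(1) cstep_iff by blast
    with \<xi>(2) show ?case by (meson rtranclp.rtrancl_into_rtrancl)
  qed
  from this[of "clen d - 1"] d(1) obtain \<xi> where
    \<xi>: "clast d = enc \<xi>" "(derives1 G)\<^sup>*\<^sup>* [Nt (start G)] \<xi>" unfolding clast_def by auto
  \<comment> \<open>Odd codes belong to terminals, even ones to nonterminals.\<close>
  have "\<exists>a. X = Tm a" if X: "X \<in> set \<xi>" for X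
  proof -
    from X obtain j where j: "j < length \<xi>" "\<xi> ! j = X" by (auto simp: in_set_conv_nth)
    with d(4)[of j] \<xi>(1) obtain q where "sym_encode X = Suc (2 * q)" by auto
    then show ?thesis by (cases X) (simp_all add: sym_encode_simps del: sym_encode.simps, presburger)
  qed
  then have "\<exists>w. \<xi> = map Tm w" by (simp add: ex_map_conv)
  then show ?thesis using \<xi> unfolding lang_def by blast
qed

section \<open>Size of the search space\<close>

lemma cfg_encode_bounds:
  shows "length (prods G) \<le> cfg_encode G" "start G \<le> cfg_encode G"
    and "(A, \<beta>) \<in> set (prods G) \<Longrightarrow> length \<beta> \<le> cfg_encode G"
    and "(A, \<beta>) \<in> set (prods G) \<Longrightarrow> X \<in> set \<beta> \<Longrightarrow> sym_encode X \<le> cfg_encode G"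
proof -
  have P: "prods_code G \<le> cfg_encode G" and "start G \<le> cfg_encode G"
    unfolding cfg_encode_def by (rule member_le_list_encode, simp)+
  then show "start G \<le> cfg_encode G" by simp
  show "length (prods G) \<le> cfg_encode G"
    using length_le_list_encode[of "map prod_rule_encode (prods G)"] P by simp
  assume A: "(A, \<beta>) \<in> set (prods G)"
  have "enc \<beta> \<le> prod_rule_encode (A, \<beta>)"
    by (simp add: prod_rule_encode_def le_prod_encode_2)
  also have "\<dots> \<le> prods_code G" using A by (intro member_le_list_encode) auto
  finally have \<beta>: "enc \<beta> \<le> cfg_encode G" using P by simp
  then show "length \<beta> \<le> cfg_encode G" using length_le_list_encode[of "map sym_encode \<beta>"] by simp
  show "sym_encode X \<le> cfg_encode G" if "X \<in> set \<beta>"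
    using member_le_list_encode[of "sym_encode X" "map sym_encode \<beta>"] that \<beta> by simp
qed

text \<open>At most \<open>K\<close> steps give at most \<open>Suc K\<close> sentential forms. Each
  step adds at most \<open>c\<close> letters to the single start symbol, and symbol codes stay below
  \<open>2 * c\<close>, inclusive, which covers the start symbol. The outer \<open>Suc\<close> makes
  the bound strict.\<close>

definition derivation_bound :: "nat \<Rightarrow> nat \<Rightarrow> nat" where
  "derivation_bound c K = Suc (list_code_bound (Suc K) (list_code_bound (Suc (K * c)) (2 * c)))"

lemma derives_imp_cderivation:
  assumes "(derives1 G ^^ k) [Nt (start G)] (map Tm w)" "k \<le> K"
  shows "\<exists>d < derivation_bound (cfg_encode G) K.
    cderivation (cfg_encode G) d \<and> clast d = enc (map Tm w)"
proof -
  let ?c = "cfg_encode G"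
  from assms(1) obtain f where f: "f 0 = [Nt (start G)]" "f k = map Tm w"
    "\<And>i. i < k \<Longrightarrow> derives1 G (f i) (f (Suc i))" unfolding relpowp_fun_conv by blast
  have bound: "length (f i) \<le> Suc (i * ?c) \<and> (\<forall>X \<in> set (f i). sym_encode X \<le> 2 * ?c)"
    if "i \<le> k" for i
    using that
  proof (induction i)
    case 0
    then show ?case using cfg_encode_bounds(2)[of G] f(1) by (simp add: sum_encode_def)
  next
    case (Suc i)
    from f(3)[of i] Suc.prems obtain A \<alpha> u v where A: "f i = u @ [Nt A] @ v"
      "f (Suc i) = u @ \<alpha> @ v" "(A, \<alpha>) \<in> set (prods G)" by (auto elim: derives1.cases)
    from Suc.IH Suc.prems have "length (f i) \<le> Suc (i * ?c)" "\<forall>X \<in> set (f i). sym_encode X \<le> 2 * ?c"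
      by auto
    with A(1,2) cfg_encode_bounds(3,4)[OF A(3)] show ?case by fastforce
  qed
  define d where "d = list_encode (map (enc \<circ> f) [0..<Suc k])"
  have d: "clen d = Suc k" "\<And>i. i \<le> k \<Longrightarrow> cnth d i = enc (f i)"
    unfolding d_def by (simp_all del: upt_Suc)
  have last: "clast d = enc (map Tm w)" unfolding clast_def d(1) using d(2)[of k] f(2) by simp
  have "cderivation ?c d"
    unfolding cderivation_def last cnth_cfg_encode
  proof (intro conjI allI impI)
    show "0 < clen d" using d by simp
    show "cnth d 0 = Suc (prod_encode (2 * start G, 0))" using d(2)[of 0] f(1) by (simp add: sum_encode_def)
    show "cstep (prods_code G) (cnth d i) (cnth d (Suc i))" if "i < clen d - 1" for i
      using that d f(3) by (auto simp: cstep_iff)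
    show "\<exists>q < cnth (enc (map Tm w)) j. cnth (enc (map Tm w)) j = Suc (2 * q)"
      if "j < clen (enc (map Tm w))" for j
      using that by (simp add: sum_encode_def)
  qed
  moreover have "d < derivation_bound ?c K"
    unfolding d_def derivation_bound_def less_Suc_eq_le
  proof (rule list_encode_le_list_code_bound)
    fix x assume "x \<in> set (map (enc \<circ> f) [0..<Suc k])"
    then obtain i where i: "i \<le> k" "x = enc (f i)" by (auto simp: less_Suc_eq_le simp del: upt_Suc)
    have "i * ?c \<le> K * ?c" using i(1) assms(2) by (intro mult_le_mono1) simp
    with bound[OF i(1)] have "length (f i) \<le> Suc (K * ?c)" by linarith
    then show "x \<le> list_code_bound (Suc (K * ?c)) (2 * ?c)"
      unfolding i(2) using bound[OF i(1)] by (intro list_encode_le_list_code_bound) auto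
  qed (use assms(2) in simp)
  ultimately show ?thesis using last by blast
qed

text \<open>The exponent is the height bound of \<open>not_subword_free_bounded\<close>; the power
  is the number of steps that \<open>gen_imp_derives\<close> allows for one root.\<close>

definition search_bound :: "nat \<Rightarrow> nat" where
  "search_bound c = derivation_bound c ((c + 2) ^ (c * Suc (2 * (c + 2) ^ Suc c)))"

lemma subseq_enc_iff: "subseq (map sym_encode (map Tm u)) (map sym_encode (map Tm w)) \<longleftrightarrow> subseq u w"
proof
  assume "subseq (map sym_encode (map Tm u)) (map sym_encode (map Tm w))"
  \<comment> \<open>Halving recovers the letter \<open>a\<close> from its code
    \<open>Suc (2 * a)\<close>.\<close>
  from subseq_map[OF this, of "\<lambda>n. n div 2"] show "subseq u w"
    by (simp add: comp_def sum_encode_def)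
qed (intro subseq_map)

lemma enc_Tm_eq_iff: "enc (map Tm u) = enc (map Tm w) \<longleftrightarrow> u = w"
  using inj_map_eq_map[OF inj_sym_encode] inj_map_eq_map[of Tm]
  by (simp add: list_encode_eq inj_def del: map_map)

text \<open>From right to left this is soundness of coded derivations. Conversely, a bounded height
  bounds the number of steps, which in turn bounds the code of the derivation.\<close>

lemma not_subword_free_iff:
  "\<not> subword_free (lang G) \<longleftrightarrow>
    (\<exists>d < search_bound (cfg_encode G). \<exists>e < search_bound (cfg_encode G).
      cderivation (cfg_encode G) d \<and> cderivation (cfg_encode G) e \<and>
      csubseq (clast d) (clast e) \<and> clast d \<noteq> clast e)" (is "_ \<longleftrightarrow> ?R")
proof
  assume ?R
  then obtain d e where de: "cderivation (cfg_encode G) d" "cderivation (cfg_encode G) e"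
    "csubseq (clast d) (clast e)" "clast d \<noteq> clast e" by blast
  from cderivation_imp_lang[OF de(1)] cderivation_imp_lang[OF de(2)] obtain u w where
    "u \<in> lang G" "w \<in> lang G" "clast d = enc (map Tm u)" "clast e = enc (map Tm w)" by blast
  with de(3,4) show "\<not> subword_free (lang G)"
    unfolding subword_free_def csubseq_list_encode by (auto simp only: csubseq_list_encode subseq_enc_iff)
next
  let ?c = "cfg_encode G"
  let ?H = "?c * Suc (2 * (?c + 2) ^ Suc ?c)"
  assume "\<not> subword_free (lang G)"
  then have "\<exists>u w. subseq u w \<and> u \<noteq> w \<and> gen G ?H [Nt (start G)] u \<and> gen G ?H [Nt (start G)] w"
    by (rule not_subword_free_bounded[rotated 2]) (rule cfg_encode_bounds(3), assumption, rule cfg_encode_bounds(1))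
  then obtain u w where
    uw: "subseq u w" "u \<noteq> w" "gen G ?H [Nt (start G)] u" "gen G ?H [Nt (start G)] w" by blast
  have *: "\<exists>d < search_bound ?c. cderivation ?c d \<and> clast d = enc (map Tm v)"
    if "gen G ?H [Nt (start G)] v" for v
  proof -
    have "\<exists>k \<le> length [Nt (start G) :: (nat, nat) sym] * (?c + 2) ^ ?H. (derives1 G ^^ k) [Nt (start G)] (map Tm v)"
      using gen_imp_derives[OF _ that, of ?c] cfg_encode_bounds(3) by blast
    then obtain k where
      "k \<le> (?c + 2) ^ ?H" "(derives1 G ^^ k) [Nt (start G)] (map Tm v)" by auto
    then show ?thesis unfolding search_bound_def by (intro derives_imp_cderivation)
  qed
  from *[OF uw(3)] *[OF uw(4)] uw(1,2) show ?R
    by (metis csubseq_list_encode subseq_enc_iff enc_Tm_eq_iff)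
qed

theorem theorem19:
  "\<exists>f :: recf. \<forall>G :: (nat, nat) cfg. wf_cfg G \<longrightarrow>
     computes f [cfg_encode G] (if subword_free (lang G) then 1 else 0)"
proof -
  have "decidable (Suc 0) (\<lambda>xs. \<not> (\<exists>d < search_bound (hd xs). \<exists>e < search_bound (hd xs).
      cderivation (hd xs) d \<and> cderivation (hd xs) e \<and>
      csubseq (clast d) (clast e) \<and> clast d \<noteq> clast e))"
    \<comment> \<open>Once unfolded, the bounds consist of powers, products and
      \<open>list_code_bound\<close>, all with closure rules.\<close>
    unfolding search_bound_def derivation_bound_def by (intro comp_intros)
  then obtain f where f: "\<And>xs. length xs = Suc 0 \<Longrightarrow> computes f xs (of_bool (\<not> (
      \<exists>d < search_bound (hd xs). \<exists>e < search_bound (hd xs).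
      cderivation (hd xs) d \<and> cderivation (hd xs) e \<and>
      csubseq (clast d) (clast e) \<and> clast d \<noteq> clast e)))"
    unfolding decidable_def computable_def by blast
  have "computes f [cfg_encode G] (if subword_free (lang G) then 1 else 0)" for G
    using f[of "[cfg_encode G]"]
    unfolding list.sel not_subword_free_iff[symmetric] by (simp add: of_bool_def)
  then show ?thesis by blast
qed

end
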